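(* Let $(A,\mathbf{C}^t_A)$ and $(B,\mathbf{C}^t_B)$ be tangled closure algebras with induced closure operators $\mathbf{C}_A$ and $\mathbf{C}_B$, and let $f:A\to B$ be a Boolean algebra homomorphism with $f(\mathbf{C}_Aa)=\mathbf{C}_Bf(a)$ for all $a\in A$. Suppose $A$ is finite. Then $f(\mathbf{C}^t_A\varGamma)=\mathbf{C}^t_B\{f\gamma:\gamma\in\varGamma\}$ for every non-empty $\varGamma\subseteq A$.
   Context: A Boolean algebra $A$ has operations $\land,\lor,-,0,1$; $a\Rightarrow b=-a\lor b$. A closure operator on $A$ is $\mathbf{C}:A\to A$ with $\mathbf{C}(a\lor b)=\mathbf{C}a\lor\mathbf{C}b$, $\mathbf{C}0=0$, $a\leq\mathbf{C}a=\mathbf{C}\mathbf{C}a$; interior $\mathbf{I}a=-\mathbf{C}-a$. $\mathcal{P}_{fin}A$ is the set of finite non-empty subsets of $A$. For $\mathbf{C}^t:\mathcal{P}_{fin}A\to A$, the induced $\mathbf{C}a=\mathbf{C}^t\{a\}$, $\mathbf{I}a=-\mathbf{C}^t\{-a\}$; $(A,\mathbf{C}^t)$ is a tangled closure algebra if $\mathbf{C}$ is a closure operator and for all $\varGamma\in\mathcal{P}_{fin}A$, $a\in A$: (Fix) $\mathbf{C}^t\varGamma\leq\bigwedge_{\gamma\in\varGamma}\mathbf{C}(\gamma\land\mathbf{C}^t\varGamma)$; (Ind) $\mathbf{I}(a\Rightarrow\bigwedge_{\gamma\in\varGamma}\mathbf{C}(\gamma\land a))\land a\leq\mathbf{C}^t\varGamma$.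 *)

theory Defs
  imports Main
begin

unbundle lattice_syntax

definition closure_operator :: "('a::boolean_algebra \<Rightarrow> 'a) \<Rightarrow> bool" where
  "closure_operator C \<longleftrightarrow>
     (\<forall>a b. C (a \<squnion> b) = C a \<squnion> C b) \<and> C \<bottom> = \<bottom> \<and> (\<forall>a. a \<le> C a \<and> C a = C (C a))"

(* An operation on the finite non-empty subsets of 'a is represented by a total function on
   'a set; its values at the empty set and at infinite sets are never constrained. *)

definition induced_closure :: "('a set \<Rightarrow> 'a) \<Rightarrow> 'a \<Rightarrow> 'a" where
  "induced_closure Ct a = Ct {a}"

definition induced_interior :: "('a::boolean_algebra set \<Rightarrow> 'a) \<Rightarrow> 'a \<Rightarrow> 'a" where
  "induced_interior Ct a = - Ct {- a}"

definition bimp :: "'a::boolean_algebra \<Rightarrow> 'a \<Rightarrow> 'a" where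
  "bimp a b = - a \<squnion> b"

definition tangled_closure_algebra :: "('a::boolean_algebra set \<Rightarrow> 'a) \<Rightarrow> bool" where
  "tangled_closure_algebra Ct \<longleftrightarrow>
     closure_operator (induced_closure Ct) \<and>
     (\<forall>\<Gamma>. finite \<Gamma> \<and> \<Gamma> \<noteq> {} \<longrightarrow>
        Ct \<Gamma> \<le> Inf_fin ((\<lambda>\<gamma>. induced_closure Ct (\<gamma> \<sqinter> Ct \<Gamma>)) ` \<Gamma>)) \<and>
     (\<forall>\<Gamma> a. finite \<Gamma> \<and> \<Gamma> \<noteq> {} \<longrightarrow>
        induced_interior Ct (bimp a (Inf_fin ((\<lambda>\<gamma>. induced_closure Ct (\<gamma> \<sqinter> a)) ` \<Gamma>))) \<sqinter> a
          \<le> Ct \<Gamma>)"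

definition boolean_hom :: "('a::boolean_algebra \<Rightarrow> 'b::boolean_algebra) \<Rightarrow> bool" where
  "boolean_hom f \<longleftrightarrow>
     (\<forall>a b. f (a \<sqinter> b) = f a \<sqinter> f b) \<and> (\<forall>a b. f (a \<squnion> b) = f a \<squnion> f b) \<and>
     (\<forall>a. f (- a) = - f a) \<and> f \<bottom> = \<bottom> \<and> f \<top> = \<top>"

end

theory Submission
  imports Defs
begin

text \<open>The tangle \<open>C\<^sup>t \<Gamma>\<close> is the greatest \<open>a\<close> with \<open>a \<le> C (\<gamma> \<sqinter> a)\<close> for all
  \<open>\<gamma> \<in> \<Gamma>\<close>, and \<open>f\<close> maps such post-fixed points in \<open>A\<close> to such post-fixed points in \<open>B\<close>;
  this gives one inequality. Conversely, since \<open>A\<close> is finite, \<open>f\<close> has a left adjoint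
  \<open>b \<mapsto> \<Sqinter>{x. b \<le> f x}\<close>, which carries post-fixed points in \<open>B\<close> back to \<open>A\<close>; applying it to
  the tangle in \<open>B\<close> gives the other inequality.\<close>

lemma closure_operator_mono:
  assumes "closure_operator C" and "a \<le> b"
  shows "C a \<le> C b"
  using assms unfolding closure_operator_def by (metis le_iff_sup)

lemma boolean_hom_mono:
  assumes "boolean_hom f" and "a \<le> b"
  shows "f a \<le> f b"
  using assms unfolding boolean_hom_def by (metis le_iff_sup)

lemma boolean_hom_Inf_fin:
  assumes "boolean_hom f" and "finite X" and "X \<noteq> {}"
  shows "f (Inf_fin X) = Inf_fin (f ` X)"
  using assms(2,3)
  by (induction X rule: finite_ne_induct) (use assms(1) in \<open>auto simp: boolean_hom_def\<close>)

lemma tangle_postfixed: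
  assumes "tangled_closure_algebra Ct" and "finite \<Gamma>" and "\<gamma> \<in> \<Gamma>"
  shows "Ct \<Gamma> \<le> induced_closure Ct (\<gamma> \<sqinter> Ct \<Gamma>)"
proof -
  have "Ct \<Gamma> \<le> Inf_fin ((\<lambda>\<gamma>. induced_closure Ct (\<gamma> \<sqinter> Ct \<Gamma>)) ` \<Gamma>)"
    using assms unfolding tangled_closure_algebra_def by blast
  also have "\<dots> \<le> induced_closure Ct (\<gamma> \<sqinter> Ct \<Gamma>)"
    using assms by (intro Inf_fin.coboundedI) auto
  finally show ?thesis .
qed

text \<open>If \<open>a\<close> is post-fixed, the implication inside the interior in (Ind) is
  \<top>. Since the closure of \<bottom> is \<bottom>, the interior of \<top> is \<top>, so (Ind)
  collapses to the claim.\<close>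

lemma tangle_greatest:
  assumes tca: "tangled_closure_algebra Ct" and fin: "finite \<Gamma>" and ne: "\<Gamma> \<noteq> {}"
    and post: "\<And>\<gamma>. \<gamma> \<in> \<Gamma> \<Longrightarrow> a \<le> induced_closure Ct (\<gamma> \<sqinter> a)"
  shows "a \<le> Ct \<Gamma>"
proof -
  let ?m = "Inf_fin ((\<lambda>\<gamma>. induced_closure Ct (\<gamma> \<sqinter> a)) ` \<Gamma>)"
  have "a \<le> ?m"
    using fin ne post by (intro Inf_fin.boundedI) auto
  hence "bimp a ?m = \<top>"
    unfolding bimp_def by (intro top_le) (metis compl_sup_top order_refl sup_mono)
  moreover have "Ct {\<bottom>} = \<bottom>"
    using tca by (simp add: tangled_closure_algebra_def closure_operator_def induced_closure_def)
  ultimately have "induced_interior Ct (bimp a ?m) = \<top>"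
    by (simp add: induced_interior_def)
  moreover have "induced_interior Ct (bimp a ?m) \<sqinter> a \<le> Ct \<Gamma>"
    using tca fin ne by (simp add: tangled_closure_algebra_def)
  ultimately show ?thesis by simp
qed

theorem theorem3p2:
  fixes CtA :: "'a::boolean_algebra set \<Rightarrow> 'a"
    and CtB :: "'b::boolean_algebra set \<Rightarrow> 'b"
    and f :: "'a \<Rightarrow> 'b"
    and \<Gamma> :: "'a set"
  assumes "tangled_closure_algebra CtA"
    and "tangled_closure_algebra CtB"
    and "boolean_hom f"
    and "\<And>a. f (induced_closure CtA a) = induced_closure CtB (f a)"
    and "finite (UNIV :: 'a set)"
    and "\<Gamma> \<noteq> {}"
  shows "f (CtA \<Gamma>) = CtB {f \<gamma> | \<gamma>. \<gamma> \<in> \<Gamma>}"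
proof -
  note tcaA = assms(1) and tcaB = assms(2) and hom = assms(3) and comm = assms(4)
    and finA = assms(5)
  have fin: "finite X" for X :: "'a set"
    using finA by (rule finite_subset[OF subset_UNIV])
  have closB: "closure_operator (induced_closure CtB)"
    using tcaB by (simp add: tangled_closure_algebra_def)
  have inf: "f (a \<sqinter> b) = f a \<sqinter> f b" for a b
    using hom by (simp add: boolean_hom_def)
  have "f (CtA \<Gamma>) = CtB (f ` \<Gamma>)"
  proof (rule antisym)
    show "f (CtA \<Gamma>) \<le> CtB (f ` \<Gamma>)"
    proof (rule tangle_greatest[OF tcaB])
      fix \<delta> assume "\<delta> \<in> f ` \<Gamma>"
      then obtain \<gamma> where \<gamma>: "\<gamma> \<in> \<Gamma>" "\<delta> = f \<gamma>" by blast
      have "f (CtA \<Gamma>) \<le> f (induced_closure CtA (\<gamma> \<sqinter> CtA \<Gamma>))"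
        by (intro boolean_hom_mono[OF hom] tangle_postfixed[OF tcaA fin \<gamma>(1)])
      \<comment> \<open>\<open>comm\<close> and \<open>inf\<close> carry \<open>f\<close> through
        the closure and the meet, so the image of a post-fixed point is post-fixed for the image
        set.\<close>
      thus "f (CtA \<Gamma>) \<le> induced_closure CtB (\<delta> \<sqinter> f (CtA \<Gamma>))"
        by (simp add: comm inf \<gamma>)
    qed (use fin assms(6) in auto)
  next
    define b where "b = CtB (f ` \<Gamma>)"
    define a where "a = Inf_fin {x. b \<le> f x}"
    \<comment> \<open>\<top> witnesses that the meet defining \<open>a\<close> is over a non-empty
      set, as \<open>Inf_fin\<close> requires.\<close>
    have "b \<le> f \<top>"
      using hom by (simp add: boolean_hom_def)
    hence ne: "{x. b \<le> f x} \<noteq> {}" by blast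
    have least: "a \<le> x" if "b \<le> f x" for x
      unfolding a_def using that fin by (intro Inf_fin.coboundedI) auto
    \<comment> \<open>\<open>f\<close> preserves this finite meet, so \<open>a\<close> itself
      satisfies the defining condition and is the least \<open>x\<close> with
      \<open>b \<le> f x\<close>.\<close>
    have "b \<le> f a"
      unfolding a_def boolean_hom_Inf_fin[OF hom fin ne]
      using fin ne by (intro Inf_fin.boundedI) auto
    have "a \<le> CtA \<Gamma>"
    proof (rule tangle_greatest[OF tcaA fin assms(6)])
      fix \<gamma> assume "\<gamma> \<in> \<Gamma>"
      hence "b \<le> induced_closure CtB (f \<gamma> \<sqinter> b)"
        unfolding b_def using fin by (intro tangle_postfixed[OF tcaB]) auto
      \<comment> \<open>Enlarging \<open>b\<close> to \<open>f a\<close> makes the bound equal to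
        \<open>f (induced_closure CtA (\<gamma> \<sqinter> a))\<close>, and \<open>least\<close>
        then transfers the inequality to the first algebra.\<close>
      also have "\<dots> \<le> induced_closure CtB (f \<gamma> \<sqinter> f a)"
        using closB \<open>b \<le> f a\<close> by (rule closure_operator_mono[OF _ inf_mono[OF order_refl]])
      finally show "a \<le> induced_closure CtA (\<gamma> \<sqinter> a)"
        by (intro least) (simp add: comm inf)
    qed
    hence "f a \<le> f (CtA \<Gamma>)"
      by (rule boolean_hom_mono[OF hom])
    with \<open>b \<le> f a\<close> show "CtB (f ` \<Gamma>) \<le> f (CtA \<Gamma>)"
      unfolding b_def by (rule order_trans)
  qed
  thus ?thesis by (simp add: Setcompr_eq_image)
qed

end
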